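(* Let $n\ge 1$ and $p\ge 1$ be integers, let $L>m>0$ and $\kappa=L/m$. Let $\Sigma(\alpha,\beta,m,L)$ be any gradient based algorithm of the form $$x(t+1)=x(t)+\sum_{j=0}^{k-1}\beta_j\big(x(t-j)-x(t-j-1)\big)-\sum_{j=0}^{k}\alpha_j\nabla_x f(x(t-j),t-j),$$ with $\alpha_j,\beta_j\in\mathbb{R}$ and $\sum_{j=0}^k\alpha_j\neq 0$, which is globally convergent with zero steady-state error for every $f\in\mathscr{F}^q_{m,L}$. Then its convergence rate $r(\alpha,\beta,m,L)$ satisfies $$r(\alpha,\beta,m,L)\;\ge\;\left(\frac{\sqrt{\kappa}-1}{\sqrt{\kappa}+1}\right)^{1/n}=\left(\frac{\sqrt{L}-\sqrt{m}}{\sqrt{L}+\sqrt{m}}\right)^{1/n}.$$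
   Context: Class of cost functions. $\mathscr{F}^q_{m,L}$ (for the fixed $n,p$) is the set of all functions $f(x,t)=\tfrac12 (x-x^*(t))^T\Delta(x-x^*(t))+c(x^*(t))$, $x\in\mathbb{R}^p$, where $\Delta=\Delta^T\in\mathbb{R}^{p\times p}$ satisfies $mI\le\Delta\le LI$, $x^*(t)=a_0+a_1t+\dots+a_{n-1}t^{n-1}$ with arbitrary constant vectors $a_i\in\mathbb{R}^p$, and $c(x^*(t))\in\mathbb{R}$. Thus $x^*(t)$ is the unique minimizer of $f(\cdot,t)$. Algorithm. $k\ge 1$ is an integer, $\alpha=(\alpha_0,\dots,\alpha_k)$, $\beta=(\beta_0,\dots,\beta_{k-1})$; the parameters do not depend on $f$. The recursion is initialized with arbitrary $x(0),\dots,x(k)\in\mathbb{R}^p$ and run for $t=k,k+1,\dots$. It is globally convergent with zero steady-state error for $f$ if $x(t)-x^*(t)\to 0$ as $t\to\infty$ for all initial values. Convergence rate. For symmetric $\Delta\in\mathbb{R}^{p\times p}$, let $\hat A(\Delta)\in\mathbb{R}^{(k+1)p\times(k+1)p}$ be the block companion matrix of the recursion $$\tilde x(t+1)=\tilde x(t)+\sum_{j=0}^{k-1}\beta_j(\tilde x(t-j)-\tilde x(t-j-1))-\sum_{j=0}^k\alpha_j\Delta\tilde x(t-j),$$ i.e. the matrix with $\chi(t+1)=\hat A(\Delta)\chi(t)$ for $\chi(t)=[\tilde x(t-k)^T\ \cdots\ \tilde x(t)^T]^T$. Then $r(\alpha,\beta,m,L)=\sup_{mI\le\Delta\le LI}\rho(\hat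 A(\Delta))$, where $\rho(\cdot)$ denotes the spectral radius. *)

theory Defs
  imports "HOL-Analysis.Derivative" "Jordan_Normal_Form.Spectral_Radius"
begin

unbundle no vec_syntax and no inner_syntax

text \<open>
  Points of $R^p$ are the members of \<^term>\<open>carrier_vec p :: real vec set\<close>, and time is discrete,
  so a time-varying cost is a function of type \<^typ>\<open>real vec \<Rightarrow> nat \<Rightarrow> real\<close>; its values
  outside the carrier are irrelevant.
\<close>

definition loewner_le :: "nat \<Rightarrow> real mat \<Rightarrow> real mat \<Rightarrow> bool" where
  "loewner_le p A B \<longleftrightarrow> (\<forall>v\<in>carrier_vec p. v \<bullet> (A *\<^sub>v v) \<le> v \<bullet> (B *\<^sub>v v))"

definition hessians :: "nat \<Rightarrow> real \<Rightarrow> real \<Rightarrow> real mat set" where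
  "hessians p m L = {\<Delta> \<in> carrier_mat p p. transpose_mat \<Delta> = \<Delta> \<and>
     loewner_le p (m \<cdot>\<^sub>m 1\<^sub>m p) \<Delta> \<and> loewner_le p \<Delta> (L \<cdot>\<^sub>m 1\<^sub>m p)}"

definition poly_traj :: "nat \<Rightarrow> nat \<Rightarrow> (nat \<Rightarrow> real vec) \<Rightarrow> nat \<Rightarrow> real vec" where
  "poly_traj n p a t = vec p (\<lambda>i. \<Sum>j<n. a j $ i * real t ^ j)"

definition cost_class :: "nat \<Rightarrow> nat \<Rightarrow> real \<Rightarrow> real \<Rightarrow> (real vec \<Rightarrow> nat \<Rightarrow> real) set" where
  "cost_class n p m L = {f. \<exists>\<Delta>\<in>hessians p m L. \<exists>a c. (\<forall>j<n. a j \<in> carrier_vec p) \<and>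
     (\<forall>t. \<forall>x\<in>carrier_vec p.
        f x t = 1 / 2 * ((x - poly_traj n p a t) \<bullet> (\<Delta> *\<^sub>v (x - poly_traj n p a t)))
                + c (poly_traj n p a t))}"

definition minimizer :: "nat \<Rightarrow> (real vec \<Rightarrow> real) \<Rightarrow> real vec" where
  "minimizer p g = arg_min g (\<lambda>x. x \<in> carrier_vec p)"

text \<open>The gradient as the vector of partial derivatives.\<close>

definition gradient :: "nat \<Rightarrow> (real vec \<Rightarrow> real) \<Rightarrow> real vec \<Rightarrow> real vec" where
  "gradient p g x = vec p (\<lambda>i. deriv (\<lambda>s. g (x + s \<cdot>\<^sub>v unit_vec p i)) 0)"

text \<open>
  Only $\alpha_0,\dots,\alpha_k$ and $\beta_0,\dots,\beta_{k-1}$ are used. For $t \ge k$ none of the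
  subtractions on natural numbers truncates.
\<close>

definition is_run :: "nat \<Rightarrow> nat \<Rightarrow> (nat \<Rightarrow> real) \<Rightarrow> (nat \<Rightarrow> real) \<Rightarrow>
    (real vec \<Rightarrow> nat \<Rightarrow> real) \<Rightarrow> (nat \<Rightarrow> real vec) \<Rightarrow> bool" where
  "is_run p k \<alpha> \<beta> f x \<longleftrightarrow> (\<forall>t. x t \<in> carrier_vec p) \<and>
     (\<forall>t\<ge>k. \<forall>i<p. x (t + 1) $ i = x t $ i
        + (\<Sum>j<k. \<beta> j * (x (t - j) $ i - x (t - j - 1) $ i))
        - (\<Sum>j\<le>k. \<alpha> j * gradient p (\<lambda>y. f y (t - j)) (x (t - j)) $ i))"

definition globally_convergent :: "nat \<Rightarrow> nat \<Rightarrow> (nat \<Rightarrow> real) \<Rightarrow> (nat \<Rightarrow> real) \<Rightarrow>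
    (real vec \<Rightarrow> nat \<Rightarrow> real) \<Rightarrow> bool" where
  "globally_convergent p k \<alpha> \<beta> f \<longleftrightarrow> (\<forall>x. is_run p k \<alpha> \<beta> f x \<longrightarrow>
     (\<forall>i<p. (\<lambda>t. x t $ i - minimizer p (\<lambda>y. f y t) $ i) \<longlonglongrightarrow> 0))"

text \<open>
  The homogeneous recursion reads
  $\tilde x(t+1) = \sum_{j=0}^{k} (c_j I - \alpha_j \Delta)\, \tilde x(t-j)$ with $c_j$ the
  coefficient below. The companion matrix acts on the stacked vector whose block $b$, for
  $b = 0,\dots,k$, is $\tilde x(t-k+b)$, so $\tilde x(t-j)$ is block $k-j$.
\<close>

definition state_coeff :: "nat \<Rightarrow> (nat \<Rightarrow> real) \<Rightarrow> nat \<Rightarrow> real" where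
  "state_coeff k \<beta> j = (if j = 0 then 1 else 0) + (if j < k then \<beta> j else 0)
     - (if j = 0 then 0 else \<beta> (j - 1))"

definition companion :: "nat \<Rightarrow> nat \<Rightarrow> (nat \<Rightarrow> real) \<Rightarrow> (nat \<Rightarrow> real) \<Rightarrow> real mat \<Rightarrow> real mat" where
  "companion p k \<alpha> \<beta> \<Delta> = mat ((k + 1) * p) ((k + 1) * p) (\<lambda>(r, s).
     if r div p < k then (if s = r + p then 1 else 0)
     else state_coeff k \<beta> (k - s div p) * (if r mod p = s mod p then 1 else 0)
          - \<alpha> (k - s div p) * \<Delta> $$ (r mod p, s mod p))"

definition conv_rate :: "nat \<Rightarrow> nat \<Rightarrow> (nat \<Rightarrow> real) \<Rightarrow> (nat \<Rightarrow> real) \<Rightarrow> real \<Rightarrow> real \<Rightarrow> real" where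
  "conv_rate p k \<alpha> \<beta> m L =
     (SUP \<Delta>\<in>hessians p m L. spectral_radius (map_mat complex_of_real (companion p k \<alpha> \<beta> \<Delta>)))"

text \<open>
  On quadratic costs \<^const>\<open>minimizer\<close> and \<^const>\<open>gradient\<close> take the expected values, and
  \<^const>\<open>companion\<close> advances the stacked state of the homogeneous recursion.
\<close>

lemma smult_mat_mult_vec1:
  assumes v: "v \<in> carrier_vec p"
  shows "(m \<cdot>\<^sub>m 1\<^sub>m p) *\<^sub>v v = (m :: real) \<cdot>\<^sub>v v"
proof (rule eq_vecI)
  fix i assume "i < dim_vec (m \<cdot>\<^sub>v v)"
  hence i: "i < p" using v by simp
  have "((m \<cdot>\<^sub>m 1\<^sub>m p) *\<^sub>v v) $ i = (\<Sum>j = 0..<p. m * (if j = i then 1 else 0) * v $ j)"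
    using i v by (auto simp: scalar_prod_def simp del: sum.delta sum.delta')
  also have "\<dots> = (\<Sum>j = 0..<p. if i = j then m * v $ j else 0)"
    by (rule sum.cong) auto
  finally show "((m \<cdot>\<^sub>m 1\<^sub>m p) *\<^sub>v v) $ i = (m \<cdot>\<^sub>v v) $ i" using i v by simp
qed (use v in simp)

lemma minimizer_quadratic:
  assumes "0 < m" and "\<Delta> \<in> hessians p m L"
    and a: "\<And>x. x \<in> carrier_vec p \<Longrightarrow> g x = 1 / 2 * ((x - z) \<bullet> (\<Delta> *\<^sub>v (x - z))) + c"
    and z: "z \<in> carrier_vec p"
  shows "minimizer p g = z"
proof -
  have D: "\<Delta> \<in> carrier_mat p p" and le: "loewner_le p (m \<cdot>\<^sub>m 1\<^sub>m p) \<Delta>"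
    using assms(2) by (auto simp: hessians_def)
  have gz: "g z = c" using a[OF z] z D by simp
  have pos: "g y > c" if y: "y \<in> carrier_vec p" "y \<noteq> z" for y
  proof -
    let ?v = "y - z"
    have v: "?v \<in> carrier_vec p" using y z by simp
    have "?v \<noteq> 0\<^sub>v p"
      using y z by (auto simp: vec_eq_iff)
    hence "0 < ?v \<bullet> ?v"
      using conjugate_square_greater_0_vec[OF v] v by simp
    moreover have "m * (?v \<bullet> ?v) = ?v \<bullet> ((m \<cdot>\<^sub>m 1\<^sub>m p) *\<^sub>v ?v)"
      using smult_mat_mult_vec1[OF v, of m] v by simp
    ultimately have "0 < ?v \<bullet> (\<Delta> *\<^sub>v ?v)"
      using le v \<open>0 < m\<close> unfolding loewner_le_def by (metis mult_pos_pos order_less_le_trans)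
    thus ?thesis using a[OF y(1)] by simp
  qed
  show ?thesis unfolding minimizer_def arg_min_def
  proof (rule some_equality)
    show "is_arg_min g (\<lambda>x. x \<in> carrier_vec p) z"
      unfolding is_arg_min_def using z gz pos by (metis less_asym less_irrefl)
  next
    fix y assume "is_arg_min g (\<lambda>x. x \<in> carrier_vec p) y"
    thus "y = z" unfolding is_arg_min_def using z gz pos by metis
  qed
qed

lemma gradient_quadratic:
  assumes D: "\<Delta> \<in> carrier_mat p p" and sym: "transpose_mat \<Delta> = \<Delta>"
    and a: "\<And>x. x \<in> carrier_vec p \<Longrightarrow> g x = 1 / 2 * ((x - z) \<bullet> (\<Delta> *\<^sub>v (x - z))) + c"
    and z: "z \<in> carrier_vec p" and x: "x \<in> carrier_vec p"
  shows "gradient p g x = \<Delta> *\<^sub>v (x - z)"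
proof (rule eq_vecI)
  show "dim_vec (gradient p g x) = dim_vec (\<Delta> *\<^sub>v (x - z))" using D by (simp add: gradient_def)
  fix i assume "i < dim_vec (\<Delta> *\<^sub>v (x - z))"
  hence i: "i < p" using D by simp
  let ?e = "unit_vec p i :: real vec" and ?v = "x - z"
  have e: "?e \<in> carrier_vec p" and v: "?v \<in> carrier_vec p" using x z by auto
  have De: "\<Delta> *\<^sub>v ?e \<in> carrier_vec p" and Dv: "\<Delta> *\<^sub>v ?v \<in> carrier_vec p" using D e v by auto
  have sym': "?v \<bullet> (\<Delta> *\<^sub>v ?e) = ?e \<bullet> (\<Delta> *\<^sub>v ?v)"
    using transpose_vec_mult_scalar[OF D e v] sym  comm_scalar_prod[OF e, of "\<Delta> *\<^sub>v ?v"] Dv by simp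
  have ei: "?e \<bullet> (\<Delta> *\<^sub>v ?v) = (\<Delta> *\<^sub>v ?v) $ i" using i Dv by simp
  have "g (x + s \<cdot>\<^sub>v ?e) = 1/2 * (?v \<bullet> (\<Delta> *\<^sub>v ?v) + 2 * s * (\<Delta> *\<^sub>v ?v) $ i + s^2 * (?e \<bullet> (\<Delta> *\<^sub>v ?e))) + c" for s
  proof -
    have se: "s \<cdot>\<^sub>v ?e \<in> carrier_vec p" using e by simp
    have 1: "x + s \<cdot>\<^sub>v ?e - z = ?v + s \<cdot>\<^sub>v ?e" using x z by auto
    have 2: "\<Delta> *\<^sub>v (?v + s \<cdot>\<^sub>v ?e) = \<Delta> *\<^sub>v ?v + s \<cdot>\<^sub>v (\<Delta> *\<^sub>v ?e)"
      using mult_add_distrib_mat_vec[OF D v se] mult_mat_vec[OF D e] by simp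
    have sDe: "s \<cdot>\<^sub>v (\<Delta> *\<^sub>v ?e) \<in> carrier_vec p" using De by simp
    have "(?v + s \<cdot>\<^sub>v ?e) \<bullet> (\<Delta> *\<^sub>v ?v + s \<cdot>\<^sub>v (\<Delta> *\<^sub>v ?e))
       = ?v \<bullet> (\<Delta> *\<^sub>v ?v) + s * (?v \<bullet> (\<Delta> *\<^sub>v ?e)) + s * (?e \<bullet> (\<Delta> *\<^sub>v ?v)) + s * (s * (?e \<bullet> (\<Delta> *\<^sub>v ?e)))"
      unfolding add_scalar_prod_distrib[OF v se add_carrier_vec[OF Dv sDe]]
        scalar_prod_add_distrib[OF v Dv sDe] scalar_prod_add_distrib[OF se Dv sDe]
      using carrier_vecD[OF e] carrier_vecD[OF v] carrier_vecD[OF De] carrier_vecD[OF Dv] by simp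
    thus ?thesis using a[of "x + s \<cdot>\<^sub>v ?e"] 1 2 x se unfolding sym' ei
      by (simp add: power2_eq_square algebra_simps)
  qed
  moreover have "((\<lambda>s. 1/2 * (?v \<bullet> (\<Delta> *\<^sub>v ?v) + 2 * s * (\<Delta> *\<^sub>v ?v) $ i + s^2 * (?e \<bullet> (\<Delta> *\<^sub>v ?e))) + c)
      has_real_derivative (\<Delta> *\<^sub>v ?v) $ i) (at 0)"
    by (auto intro!: derivative_eq_intros)
  ultimately have "((\<lambda>s. g (x + s \<cdot>\<^sub>v ?e)) has_real_derivative (\<Delta> *\<^sub>v ?v) $ i) (at 0)" by simp
  thus "gradient p g x $ i = (\<Delta> *\<^sub>v (x - z)) $ i"
    using i by (simp add: gradient_def DERIV_imp_deriv)
qed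

definition stacked :: "nat \<Rightarrow> nat \<Rightarrow> (nat \<Rightarrow> real vec) \<Rightarrow> nat \<Rightarrow> real vec" where
  "stacked p k x t = vec ((k + 1) * p) (\<lambda>r. x (t - k + r div p) $ (r mod p))"

lemma mat_vec_index:
  assumes "A \<in> carrier_mat N N" and "v \<in> carrier_vec N" and "r < N"
  shows "(A *\<^sub>v v) $ r = (\<Sum>s<N. A $$ (r, s) * v $ s)"
  using assms by (auto simp: scalar_prod_def lessThan_atLeast0 intro!: sum.cong)

lemma sum_blocks: "(\<Sum>s<(k+1)*p. F s) = (\<Sum>b\<le>k. \<Sum>l<p. F (b * p + l))" for F :: "nat \<Rightarrow> real"
proof -
  have "(\<Sum>s<K*p. F s) = (\<Sum>b<K. \<Sum>l<p. F (b * p + l))" for K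
  proof (induction K)
    case (Suc K)
    have "{..<Suc K * p} = {..<K*p} \<union> {K*p..<K*p+p}" by auto
    hence "(\<Sum>s<Suc K*p. F s) = (\<Sum>s<K*p. F s) + (\<Sum>s=K*p..<K*p+p. F s)"
      by (simp add: sum.union_disjoint ivl_disj_int)
    also have "(\<Sum>s=K*p..<K*p+p. F s) = (\<Sum>l<p. F (K * p + l))"
      using sum.shift_bounds_nat_ivl[of F 0 "K*p" p] by (simp add: lessThan_atLeast0 add.commute)
    finally show ?case using Suc by simp
  qed simp
  from this[of "k+1"] show ?thesis by (simp add: lessThan_Suc_atMost)
qed

lemma companion_step:
  assumes k: "k \<ge> 1" and D: "\<Delta> \<in> carrier_mat p p" and x: "\<And>t. x t \<in> carrier_vec p" and t: "t \<ge> k"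
    and rec: "\<And>i. i < p \<Longrightarrow> x (t + 1) $ i = x t $ i
        + (\<Sum>j<k. \<beta> j * (x (t - j) $ i - x (t - j - 1) $ i))
        - (\<Sum>j\<le>k. \<alpha> j * (\<Delta> *\<^sub>v x (t - j)) $ i)"
  shows "stacked p k x (t + 1) = companion p k \<alpha> \<beta> \<Delta> *\<^sub>v stacked p k x t"
proof (rule eq_vecI)
  show "dim_vec (stacked p k x (t + 1)) = dim_vec (companion p k \<alpha> \<beta> \<Delta> *\<^sub>v stacked p k x t)"
    by (simp add: stacked_def companion_def)
  fix r assume "r < dim_vec (companion p k \<alpha> \<beta> \<Delta> *\<^sub>v stacked p k x t)"
  hence r: "r < (k+1)*p" by (simp add: companion_def)
  hence p: "p > 0" by (cases p) auto
  let ?i = "r mod p"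
  have i: "?i < p" using p by simp
  have bk: "r div p \<le> k" using r p by (metis Suc_eq_plus1 less_Suc_eq_le less_mult_imp_div_less)
  have L: "stacked p k x (t + 1) $ r = x (t + 1 - k + r div p) $ ?i"
    unfolding stacked_def by (rule index_vec[OF r])
  have R: "(companion p k \<alpha> \<beta> \<Delta> *\<^sub>v stacked p k x t) $ r = (\<Sum>s<(k+1)*p. companion p k \<alpha> \<beta> \<Delta> $$ (r,s) * stacked p k x t $ s)"
    by (rule mat_vec_index[OF _ _ r]) (simp_all add: companion_def stacked_def)
  show "stacked p k x (t + 1) $ r = (companion p k \<alpha> \<beta> \<Delta> *\<^sub>v stacked p k x t) $ r"
  proof (cases "r div p < k")
    case True
    hence "r < k * p" using p by (simp add: div_less_iff_less_mult)
    hence rp: "r + p < (k+1)*p" by simp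
    have "(\<Sum>s<(k+1)*p. companion p k \<alpha> \<beta> \<Delta> $$ (r,s) * stacked p k x t $ s)
       = (\<Sum>s<(k+1)*p. if s = r + p then stacked p k x t $ s else 0)"
      by (rule sum.cong) (use r True in \<open>auto simp: companion_def\<close>)
    also have "\<dots> = stacked p k x t $ (r + p)" using rp by simp
    also have "\<dots> = x (t - k + Suc (r div p)) $ ?i" using rp p by (simp add: stacked_def)
    finally show ?thesis using L R t by (simp add: Suc_diff_le)
  next
    case False
    hence b: "r div p = k" using bk by simp
    have inner: "(\<Sum>l<p. companion p k \<alpha> \<beta> \<Delta> $$ (r,b*p+l) * stacked p k x t $ (b*p+l))
      = state_coeff k \<beta> (k - b) * x (t - (k - b)) $ ?i - \<alpha> (k - b) * (\<Delta> *\<^sub>v x (t - (k - b))) $ ?i"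
      if bk: "b \<le> k" for b
    proof -
      have "(\<Sum>l<p. companion p k \<alpha> \<beta> \<Delta> $$ (r,b*p+l) * stacked p k x t $ (b*p+l))
        = (\<Sum>l<p. (if l = ?i then state_coeff k \<beta> (k - b) * x (t - (k - b)) $ l else 0)
             - \<alpha> (k - b) * (\<Delta> $$ (?i, l) * x (t - (k - b)) $ l))"
      proof (rule sum.cong[OF refl])
        fix l assume "l \<in> {..<p}" hence l: "l < p" by simp
        have "b*p+l < b*p+p" using l by simp
        also have "\<dots> \<le> (k+1)*p" using bk by (metis add.commute add_le_mono1 mult_Suc mult_le_mono1 Suc_eq_plus1 Suc_le_mono)
        finally have lt: "b*p+l < (k+1)*p" .
        have d: "(b*p+l) div p = b" "(b*p+l) mod p = l" using l by auto
        have tt: "t - k + b = t - (k - b)" using t bk by simp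
        show "companion p k \<alpha> \<beta> \<Delta> $$ (r,b*p+l) * stacked p k x t $ (b*p+l) =
          (if l = ?i then state_coeff k \<beta> (k - b) * x (t - (k - b)) $ l else 0)
             - \<alpha> (k - b) * (\<Delta> $$ (?i, l) * x (t - (k - b)) $ l)"
          using r lt d tt False by (auto simp: companion_def stacked_def algebra_simps)
      qed
      also have "\<dots> = state_coeff k \<beta> (k - b) * x (t - (k - b)) $ ?i - \<alpha> (k - b) * (\<Delta> *\<^sub>v x (t - (k - b))) $ ?i"
        using i D x[of "t - (k-b)"] 
        by (simp add: sum_subtractf sum_distrib_left[symmetric] scalar_prod_def lessThan_atLeast0)
      finally show ?thesis .
    qed
    have "(\<Sum>s<(k+1)*p. companion p k \<alpha> \<beta> \<Delta> $$ (r,s) * stacked p k x t $ s)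
      = (\<Sum>b\<le>k. state_coeff k \<beta> (k - b) * x (t - (k - b)) $ ?i - \<alpha> (k - b) * (\<Delta> *\<^sub>v x (t - (k - b))) $ ?i)"
      unfolding sum_blocks by (rule sum.cong) (use inner in auto)
    also have "\<dots> = (\<Sum>j\<le>k. state_coeff k \<beta> j * x (t - j) $ ?i - \<alpha> j * (\<Delta> *\<^sub>v x (t - j)) $ ?i)"
      by (rule sum.reindex_bij_witness[of _ "\<lambda>j. k - j" "\<lambda>j. k - j"]) auto
    also have "\<dots> = (\<Sum>j\<le>k. state_coeff k \<beta> j * x (t - j) $ ?i) - (\<Sum>j\<le>k. \<alpha> j * (\<Delta> *\<^sub>v x (t - j)) $ ?i)"
      by (simp add: sum_subtractf)
    also have "(\<Sum>j\<le>k. state_coeff k \<beta> j * x (t - j) $ ?i)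
      = x t $ ?i + (\<Sum>j<k. \<beta> j * (x (t - j) $ ?i - x (t - j - 1) $ ?i))"
    proof -
      have "(\<Sum>j\<le>k. state_coeff k \<beta> j * x (t - j) $ ?i) =
        (\<Sum>j\<le>k. if j = 0 then x t $ ?i else 0) + (\<Sum>j\<le>k. if j < k then \<beta> j * x (t - j) $ ?i else 0)
         - (\<Sum>j\<le>k. if j = 0 then 0 else \<beta> (j - 1) * x (t - j) $ ?i)"
        unfolding sum.distrib[symmetric] sum_subtractf[symmetric]
        by (rule sum.cong) (auto simp: state_coeff_def algebra_simps)
      also have "(\<Sum>j\<le>k. if j < k then \<beta> j * x (t - j) $ ?i else 0) = (\<Sum>j<k. \<beta> j * x (t - j) $ ?i)"
        by (simp add: lessThan_Suc_atMost[symmetric])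
      also have "(\<Sum>j\<le>k. if j = 0 then 0 else \<beta> (j - 1) * x (t - j) $ ?i) = (\<Sum>j<k. \<beta> j * x (t - j - 1) $ ?i)"
        by (simp only: lessThan_Suc_atMost[symmetric] sum.lessThan_Suc_shift) simp
      finally show ?thesis by (simp add: sum_subtractf right_diff_distrib)
    qed
    finally show ?thesis using L R b rec[OF i] t by simp
  qed
qed

end

theory Submission
  imports Defs "HOL-Complex_Analysis.Conformal_Mappings"
begin

text \<open>
  In the delay variable $w = 1/z$ put $P(w) = 1 - \sum_j c_j w^{j+1}$, with $c_j$ the coefficients
  \<^const>\<open>state_coeff\<close>, and $A(w) = \sum_j \alpha_j w^{j+1}$. Tracking the minimizers $t^d$,
  $d < n$, forces a polynomial in $t$ to tend to zero, hence to vanish; these moment conditions say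
  that $(1-w)^n$ divides $P$. For $\Delta = dI$ with $m \le d \le L$, the inverses of the zeros of
  $P + dA$ are eigenvalues of the companion matrix, so if the rate is less than $1/R$ then
  $P + dA$ has no zero with $|w| \le R$. Consequently $h = (P + LA)/(P + mA)$ omits the
  nonpositive reals on this disc and $g = \sqrt{h}$ maps it to the right half-plane, with
  $g(0) = 1$, while $(g - \sqrt{\kappa})/(g + \sqrt{\kappa})$ vanishes to order $n$ at $w = 1$.
  Dividing by the $n$th power of the Blaschke factor of $1$ and comparing with the value at $0$
  gives $(\sqrt{\kappa} - 1)/(\sqrt{\kappa} + 1) \le R^{-n}$ by the maximum modulus principle.
\<close>

unbundle no vec_syntax and no inner_syntax

section \<open>Order of vanishing at 1 and the maximum modulus bound\<close>

text \<open>A point of the closed right half-plane is at least as near to s as to -s. Hence (g -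
  s)/(g + s) stays in the closed unit disc.\<close>

lemma norm_diff_le_norm_add_of_real:
  fixes g :: complex
  assumes "0 \<le> Re g" and "0 \<le> s"
  shows "norm (g - of_real s) \<le> norm (g + of_real s)"
proof -
  have "(Re g - s)\<^sup>2 \<le> (Re g + s)\<^sup>2"
    using assms by (simp add: power2_eq_square algebra_simps)
  thus ?thesis by (simp add: cmod_def)
qed

text \<open>The operator x d/dx multiplies the i-th coefficient by i, so the d-th moment is the
  value at 1 of its d-th iterate on \<open>P\<close>. In the induction \<open>W\<close> = x P' has
  the moments of \<open>P\<close> shifted by one. It has the same order at 1 as P', because x does
  not vanish there, and the moment d = 0 supplies the root that raises this order by one.\<close>

lemma order_of_moment_conditions:
  fixes P :: "'a :: field_char_0 poly"
  assumes "\<And>d. d < n \<Longrightarrow> (\<Sum>i\<le>N. coeff P i * of_nat i ^ d) = 0" and "degree P \<le> N"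
  shows "P = 0 \<or> n \<le> order 1 P"
  using assms
proof (induction n arbitrary: P)
  case (Suc n)
  have root: "poly P 1 = 0"
    using Suc.prems(1)[of 0] Suc.prems(2)
    by (simp add: poly_altdef sum.mono_neutral_right[of "{..N}" "{..degree P}"] coeff_eq_0)
  define W where "W = pCons 0 (pderiv P)"
  have cW: "coeff W i = of_nat i * coeff P i" for i
    by (cases i) (simp_all add: W_def coeff_pderiv)
  have dW: "degree W \<le> N"
    using Suc.prems(2) by (intro degree_le) (auto simp: cW coeff_eq_0)
  have "W = 0 \<or> n \<le> order 1 W"
  proof (rule Suc.IH[OF _ dW])
    fix d assume "d < n"
    thus "(\<Sum>i\<le>N. coeff W i * of_nat i ^ d) = 0"
      using Suc.prems(1)[of "Suc d"] by (simp add: cW mult_ac)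
  qed
  moreover have "order 1 W = order 1 (pderiv P)" if "pderiv P \<noteq> 0"
  proof -
    have "W = [:0, 1:] * pderiv P" by (simp add: W_def)
    moreover have "[:0, 1:] * pderiv P \<noteq> 0" using that by simp
    ultimately show ?thesis using order_mult[of "[:0, 1:]" "pderiv P" 1] by (simp add: order_0I)
  qed
  ultimately have "n \<le> order 1 (pderiv P)" if "pderiv P \<noteq> 0"
    using that by (auto simp: W_def)
  moreover have "P = 0" if "pderiv P = 0"
    using that root by (auto simp: pderiv_eq_0_iff elim: degree_eq_zeroE)
  ultimately show ?case
    using root order_pderiv[of P 1] by (cases "pderiv P = 0") auto
qed simp

lemma sqrt_ratio_eq:
  assumes "0 < m" and "0 < L"
  shows "(sqrt (L / m) - 1) / (sqrt (L / m) + 1) = (sqrt L - sqrt m) / (sqrt L + sqrt m)"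
proof -
  have "sqrt (L / m) - 1 = (sqrt L - sqrt m) / sqrt m"
    and "sqrt (L / m) + 1 = (sqrt L + sqrt m) / sqrt m"
    using assms by (simp_all add: real_sqrt_divide field_simps)
  thus ?thesis using assms by simp
qed

text \<open>A Schwarz-type estimate: a function from the disc of radius R to the closed unit disc
  with a zero of order n at 1 has modulus at most R^(-n) at 0, since the Blaschke factor of 1 takes
  the value 1/R there.\<close>

lemma robust_root_bound:
  fixes P A Q :: "complex poly" and m L R :: real
  assumes P: "P = [:1, -1:] ^ n * Q" and P0: "poly P 0 = 1" and A0: "poly A 0 = 0"
    and m: "0 < m" and L: "m < L" and R: "1 < R"
    and nz: "\<And>w d. \<lbrakk>norm w \<le> R; m \<le> d; d \<le> L\<rbrakk> \<Longrightarrow> poly P w + of_real d * poly A w \<noteq> 0"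
  shows "R ^ n * ((sqrt L - sqrt m) / (sqrt L + sqrt m)) \<le> 1"
proof -
  define s where "s = sqrt (L / m)"
  have s1: "1 < s" and s2: "s ^ 2 = L / m" using m L by (auto simp: s_def)
  define N where "N w = poly P w + of_real L * poly A w" for w
  define D where "D w = poly P w + of_real m * poly A w" for w
  define g where "g w = csqrt (N w / D w)" for w
  define F where "F w = of_real (1 - s\<^sup>2) * poly Q w * (of_real (R\<^sup>2) - w) ^ n /
      (of_real (R ^ n) * D w * (g w + of_real s)\<^sup>2)" for w
  \<comment> \<open>With the Blaschke factor \<open>b w = R * (1 - w) / (R\<^sup>2 - w)\<close> one has
    \<open>F w = (g w - s) / ((g w + s) * b w ^ n)\<close>; its singularity at \<open>w = 1\<close> is removed by hand, because
    \<open>(g w)\<^sup>2 - s\<^sup>2 = (1 - s\<^sup>2) * P w / D w\<close>. On the circle \<open>norm w = R\<close> the factor \<open>b\<close> has modulus 1.\<close>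
  have D: "D w \<noteq> 0" if "norm w \<le> R" for w using nz[OF that, of m] L by (simp add: D_def)
  have slit: "N w / D w \<notin> \<real>\<^sub>\<le>\<^sub>0" if w: "norm w \<le> R" for w
  proof
    assume "N w / D w \<in> \<real>\<^sub>\<le>\<^sub>0"
    then obtain x where x: "0 \<le> x" "N w / D w = - of_real x"
      by (metis nonpos_Reals_cases of_real_minus neg_0_le_iff_le minus_minus)
    hence e: "N w + of_real x * D w = 0" using D[OF w] by (simp add: field_simps)
    \<comment> \<open>A value -x of the quotient with x >= 0 means N + xD = 0. This sum is (1 + x)(P
      + dA) for the convex combination d of L and m with weights 1 and x, and d lies in [m, L],
      where zeros are excluded. So the quotient avoids the branch cut of
      \<open>csqrt\<close>.\<close>
    define d where "d = (L + x * m) / (1 + x)"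
    have "(1 + x) * (d - m) = L - m" "(1 + x) * (L - d) = x * (L - m)"
      using x by (simp_all add: d_def field_simps)
    hence "0 \<le> (1 + x) * (d - m)" "0 \<le> (1 + x) * (L - d)" using x L by auto
    hence d: "m \<le> d" "d \<le> L" using x by (auto simp: zero_le_mult_iff)
    have d': "of_real (1 + x) * of_real d = (of_real (L + x * m) :: complex)"
      using x by (simp only: of_real_mult[symmetric] of_real_eq_iff) (simp add: d_def)
    have "of_real (1 + x) * (poly P w + of_real d * poly A w) =
        of_real (1 + x) * poly P w + of_real (L + x * m) * poly A w"
      unfolding d'[symmetric] by (simp add: algebra_simps)
    also have "\<dots> = N w + of_real x * D w" by (simp add: N_def D_def algebra_simps)
    finally have "of_real (1 + x) * (poly P w + of_real d * poly A w) = 0" using e by simp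
    moreover have "of_real (1 + x) \<noteq> (0 :: complex)"
      using x by (simp only: of_real_eq_0_iff)
    ultimately show False using nz[OF w d] by (simp only: mult_eq_0_iff) blast
  qed
  have Reg: "0 \<le> Re (g w)" for w unfolding g_def by (rule Re_csqrt)
  have gs: "g w + of_real s \<noteq> 0" for w
  proof
    assume "g w + of_real s = 0"
    hence "Re (g w + of_real s) = 0" by simp
    thus False using Reg[of w] s1 by simp
  qed
  have bnd: "norm (F w) \<le> 1" if w: "norm w = R" for w
  proof -
    have w1: "1 - w \<noteq> 0" using w R by auto
    \<comment> \<open>On the circle R^2 is w times its conjugate, which makes the numerator and
      denominator of the Blaschke factor equal in modulus.\<close>
    have ww: "of_real (R\<^sup>2) - w = w * (cnj w - 1)"
      using w by (simp add: algebra_simps complex_norm_square[symmetric])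
    have "norm (of_real (R\<^sup>2) - w) = R * norm (1 - w)"
      unfolding ww norm_mult w
      by (metis complex_cnj_diff complex_cnj_one complex_mod_cnj norm_minus_commute)
    hence nw: "norm ((of_real (R\<^sup>2) - w) ^ n) = R ^ n * norm ((1 - w) ^ n)"
      by (simp add: norm_power power_mult_distrib)
    have Dw: "D w \<noteq> 0" using D w by simp
    have "(g w)\<^sup>2 = N w / D w" by (simp add: g_def)
    hence "(g w)\<^sup>2 * D w = N w" using Dw by simp
    \<comment> \<open>The choice of s gives s^2 m = L, so the terms in A cancel in N - s^2 D and (1
      - s^2) P remains.\<close>
    moreover have "of_real (s\<^sup>2) * D w = of_real (s\<^sup>2) * poly P w + of_real L * poly A w"
      using m by (simp add: D_def s2 algebra_simps)
    ultimately have key: "of_real (1 - s\<^sup>2) * poly P w = ((g w)\<^sup>2 - of_real (s\<^sup>2)) * D w"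
      by (simp add: N_def algebra_simps)
    have "norm (F w) = norm (of_real (1 - s\<^sup>2) * poly Q w) * (R ^ n * norm ((1 - w) ^ n)) /
        (R ^ n * norm (D w) * norm (g w + of_real s) ^ 2)"
      unfolding F_def using nw R by (simp add: norm_mult norm_divide norm_power)
    also have "\<dots> = norm (of_real (1 - s\<^sup>2) * poly P w) / (norm (D w) * norm (g w + of_real s) ^ 2)"
      using R by (simp add: P norm_mult norm_power)
    also have "\<dots> = norm ((g w)\<^sup>2 - of_real (s\<^sup>2)) / norm (g w + of_real s) ^ 2"
      unfolding key using Dw by (simp add: norm_mult)
    also have "(g w)\<^sup>2 - of_real (s\<^sup>2) = (g w - of_real s) * (g w + of_real s)"
      by (simp add: power2_eq_square algebra_simps)
    also have "norm \<dots> / norm (g w + of_real s) ^ 2 = norm (g w - of_real s) / norm (g w + of_real s)"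
      using gs[of w] by (simp add: norm_mult power2_eq_square)
    also have "\<dots> \<le> 1"
      using norm_diff_le_norm_add_of_real[OF Reg, of s w] s1 gs[of w] by simp
    finally show ?thesis .
  qed
  have ratio: "continuous_on (cball 0 R) (\<lambda>w. N w / D w)" "(\<lambda>w. N w / D w) holomorphic_on ball 0 R"
    using D unfolding N_def D_def by (auto intro!: continuous_intros holomorphic_intros)
  have g: "continuous_on (cball 0 R) g" "g holomorphic_on ball 0 R"
    unfolding g_def using slit
    by (auto intro!: continuous_on_compose2[OF continuous_on_csqrt ratio(1)] holomorphic_on_csqrt'[OF ratio(2)])
  have DD: "continuous_on (cball 0 R) D" "D holomorphic_on ball 0 R"
    unfolding D_def by (auto intro!: continuous_intros holomorphic_intros)
  have nz: "of_real (R ^ n) * D w * (g w + of_real s)\<^sup>2 \<noteq> 0" if "norm w \<le> R" for w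
    using D[OF that] gs[of w] R by simp
  have cont: "continuous_on (cball 0 R) F"
    unfolding F_def using nz
    by (intro continuous_on_divide continuous_on_mult continuous_on_power continuous_on_add
        continuous_on_diff continuous_on_const continuous_on_id continuous_on_poly g DD) auto
  have hol: "F holomorphic_on ball 0 R"
    unfolding F_def using nz
    by (intro holomorphic_on_divide holomorphic_on_mult holomorphic_on_power holomorphic_on_add
        holomorphic_on_diff holomorphic_on_const holomorphic_on_ident poly_holomorphic_on g DD) auto
  have "norm (F 0) \<le> 1"
    by (rule maximum_modulus_frontier[of F "cball 0 R"])
       (use hol cont bnd R in auto)
  \<comment> \<open>At the centre N = D = 1, hence g = 1, and \<open>F 0\<close> is minus R^n (s -
    1)/(s + 1).\<close>
  moreover have "poly Q 0 = 1" using P P0 by simp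
  hence "F 0 = of_real ((1 - s\<^sup>2) * R ^ n / (1 + s)\<^sup>2)"
    using R P0 A0 by (simp add: F_def g_def N_def D_def power_mult power2_eq_square power_mult_distrib)
  moreover have "(1 - s\<^sup>2) * R ^ n / (1 + s)\<^sup>2 = - (R ^ n * ((s - 1) / (s + 1)))"
    using s1 by (simp add: power2_eq_square divide_simps) (simp add: algebra_simps)
  ultimately have "R ^ n * ((s - 1) / (s + 1)) \<le> 1"
    using s1 R by (simp add: abs_mult del: of_real_mult of_real_divide of_real_power of_real_diff of_real_add of_real_minus)
  moreover have "(s - 1) / (s + 1) = (sqrt L - sqrt m) / (sqrt L + sqrt m)"
    unfolding s_def using m L by (intro sqrt_ratio_eq) auto
  ultimately show ?thesis by simp
qed

section \<open>Uniform bounds on Hessians and spectral radii\<close>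

lemma scalar_hessian:
  assumes "m \<le> d" and "d \<le> L"
  shows "d \<cdot>\<^sub>m 1\<^sub>m p \<in> hessians p m L"
proof -
  have "(c \<cdot>\<^sub>m 1\<^sub>m p) *\<^sub>v v = c \<cdot>\<^sub>v v" if "v \<in> carrier_vec p" for c :: real and v
    using smult_mat_mult_vec1[OF that] .
  moreover have "0 \<le> v \<bullet> v" for v :: "real vec"
    by (simp add: scalar_prod_def sum_nonneg)
  ultimately show ?thesis
    using assms by (auto simp: hessians_def loewner_le_def transpose_mat_def mult_right_mono)
qed

text \<open>Evaluating the form at such vectors turns the Loewner bounds into bounds on single
  entries. The case i = j is allowed, the vector then being (1 + c) times a unit vector.\<close>

lemma quadratic_form_unit_pair:
  fixes D :: "real mat"
  assumes D: "D \<in> carrier_mat p p" and ij: "i < p" "j < p"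
  shows "(unit_vec p i + c \<cdot>\<^sub>v unit_vec p j) \<bullet> (D *\<^sub>v (unit_vec p i + c \<cdot>\<^sub>v unit_vec p j)) =
    D $$ (i, i) + c * D $$ (i, j) + c * D $$ (j, i) + c\<^sup>2 * D $$ (j, j)"
proof -
  let ?v = "unit_vec p i + c \<cdot>\<^sub>v unit_vec p j"
  have pick: "(\<Sum>s = 0..<p. ((if s = i then 1 else 0) + c * (if s = j then 1 else 0)) * f s) = f i + c * f j"
    for f :: "nat \<Rightarrow> real"
  proof -
    have "(\<Sum>s = 0..<p. ((if s = i then 1 else 0) + c * (if s = j then 1 else 0)) * f s) =
        (\<Sum>s = 0..<p. (if s = i then f s else 0) + (if s = j then c * f s else 0))"
      by (rule sum.cong) (auto simp: distrib_right)
    thus ?thesis using ij by (simp add: sum.distrib)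
  qed
  have Dv: "(D *\<^sub>v ?v) $ r = D $$ (r, i) + c * D $$ (r, j)" if "r < p" for r
    using that D ij pick[of "\<lambda>s. D $$ (r, s)"] by (simp add: scalar_prod_def unit_vec_def mult.commute)
  have "?v \<bullet> (D *\<^sub>v ?v) = (\<Sum>s = 0..<p. ((if s = i then 1 else 0) + c * (if s = j then 1 else 0)) *
      (D $$ (s, i) + c * D $$ (s, j)))"
    using D ij Dv by (simp add: scalar_prod_def unit_vec_def)
  also have "\<dots> = (D $$ (i, i) + c * D $$ (i, j)) + c * (D $$ (j, i) + c * D $$ (j, j))"
    by (rule pick)
  finally show ?thesis by (simp add: power2_eq_square algebra_simps)
qed

text \<open>The choice c = 0 isolates a diagonal entry. Off the diagonal the forms for c = 1 and c =
  -1 both lie between 0 and 2L and differ by four times the entry. The constant is crude; what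
  matters is that it does not depend on \<open>D\<close>.\<close>

lemma hessian_entry_bound:
  assumes D: "D \<in> hessians p m L" and m: "0 \<le> m" and ij: "i < p" "j < p"
  shows "\<bar>D $$ (i, j)\<bar> \<le> 2 * L"
proof -
  have Dc: "D \<in> carrier_mat p p" and sym: "transpose_mat D = D"
    and lo: "loewner_le p (m \<cdot>\<^sub>m 1\<^sub>m p) D" and up: "loewner_le p D (L \<cdot>\<^sub>m 1\<^sub>m p)"
    using D by (auto simp: hessians_def)
  have s: "D $$ (j, i) = D $$ (i, j)"
    using sym Dc ij by (metis carrier_matD index_transpose_mat(1))
  have *: "m * (if i = j then (1 + c)\<^sup>2 else 1 + c\<^sup>2) \<le> D $$ (i, i) + 2 * c * D $$ (i, j) + c\<^sup>2 * D $$ (j, j)"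
          "D $$ (i, i) + 2 * c * D $$ (i, j) + c\<^sup>2 * D $$ (j, j) \<le> L * (if i = j then (1 + c)\<^sup>2 else 1 + c\<^sup>2)" for c
  proof -
    let ?v = "unit_vec p i + c \<cdot>\<^sub>v unit_vec p j"
    have v: "?v \<in> carrier_vec p" by simp
    have sc: "?v \<bullet> ((a \<cdot>\<^sub>m 1\<^sub>m p) *\<^sub>v ?v) = a * (if i = j then (1 + c)\<^sup>2 else 1 + c\<^sup>2)" for a
      using quadratic_form_unit_pair[of "a \<cdot>\<^sub>m 1\<^sub>m p" p i j c] ij
      by (simp add: power2_eq_square algebra_simps)
    show "m * (if i = j then (1 + c)\<^sup>2 else 1 + c\<^sup>2) \<le> D $$ (i, i) + 2 * c * D $$ (i, j) + c\<^sup>2 * D $$ (j, j)"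
      using lo[unfolded loewner_le_def, rule_format, OF v]
      unfolding sc quadratic_form_unit_pair[OF Dc ij] s by simp
    show "D $$ (i, i) + 2 * c * D $$ (i, j) + c\<^sup>2 * D $$ (j, j) \<le> L * (if i = j then (1 + c)\<^sup>2 else 1 + c\<^sup>2)"
      using up[unfolded loewner_le_def, rule_format, OF v]
      unfolding sc quadratic_form_unit_pair[OF Dc ij] s by simp
  qed
  show ?thesis
  proof (cases "i = j")
    case True
    thus ?thesis using *[of 0] m by simp
  next
    case False
    thus ?thesis using *[of 1] *[of "-1"] m by (simp add: abs_le_iff)
  qed
qed

text \<open>Compare both sides of the eigenvector equation in the row where the eigenvector has its
  entry of largest modulus.\<close>

lemma eigenvalue_norm_le:
  fixes A :: "complex mat"
  assumes A: "A \<in> carrier_mat N N" and ev: "eigenvalue A z"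
    and M: "\<And>i j. \<lbrakk>i < N; j < N\<rbrakk> \<Longrightarrow> norm (A $$ (i, j)) \<le> M"
  shows "norm z \<le> real N * M"
proof -
  obtain v where v: "v \<in> carrier_vec N" "v \<noteq> 0\<^sub>v N" "A *\<^sub>v v = z \<cdot>\<^sub>v v"
    using ev A by (auto simp: eigenvalue_def eigenvector_def)
  have N: "N > 0" using v by (cases N) auto
  obtain r where r: "r < N" "\<And>s. s < N \<Longrightarrow> norm (v $ s) \<le> norm (v $ r)"
  proof -
    have "finite ((\<lambda>s. norm (v $ s)) ` {..<N})" "(\<lambda>s. norm (v $ s)) ` {..<N} \<noteq> {}"
      using N by auto
    from Max_in[OF this] Max_ge[OF this(1)] that show ?thesis by (metis (no_types, lifting) imageE image_eqI lessThan_iff)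
  qed
  have pos: "0 < norm (v $ r)"
  proof (rule ccontr)
    assume "\<not> 0 < norm (v $ r)"
    hence "v $ s = 0" if "s < N" for s using r(2)[OF that] by (metis norm_le_zero_iff order_trans not_less)
    thus False using v by (auto simp: vec_eq_iff)
  qed
  have "z * v $ r = (\<Sum>s = 0..<N. A $$ (r, s) * v $ s)"
    using arg_cong[OF v(3), of "\<lambda>u. u $ r"] A v(1) r(1) by (simp add: scalar_prod_def)
  hence "norm z * norm (v $ r) \<le> (\<Sum>s = 0..<N. norm (A $$ (r, s)) * norm (v $ s))"
    by (metis (no_types, lifting) norm_mult norm_sum sum.cong)
  also have "\<dots> \<le> (\<Sum>s = 0..<N. M * norm (v $ r))"
    using r M by (intro sum_mono mult_mono) (auto intro: order_trans[OF norm_ge_zero])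
  finally show ?thesis using pos by (simp add: mult.assoc[symmetric])
qed

lemma companion_carrier: "companion p k \<alpha> \<beta> D \<in> carrier_mat ((k + 1) * p) ((k + 1) * p)"
  unfolding companion_def by (rule mat_carrier)

text \<open>The real supremum in \<open>conv_rate\<close> dominates its members only once the set is
  known to be bounded above.\<close>

lemma bdd_above_spectral_radius_companion:
  assumes m: "0 \<le> m" and p: "1 \<le> p"
  shows "bdd_above ((\<lambda>D. spectral_radius (map_mat complex_of_real (companion p k \<alpha> \<beta> D))) ` hessians p m L)"
proof -
  define C where "C = (\<Sum>j\<le>k. \<bar>state_coeff k \<beta> j\<bar> + \<bar>\<alpha> j\<bar> * (2 * L))"
  \<comment> \<open>The summand 1 covers the shift rows, whose entries are 0 or 1, and C covers the
    last block row.\<close>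
  have "spectral_radius (map_mat complex_of_real (companion p k \<alpha> \<beta> D)) \<le>
      real ((k + 1) * p) * (1 + \<bar>C\<bar>)" if D: "D \<in> hessians p m L" for D
  proof -
    let ?A = "map_mat complex_of_real (companion p k \<alpha> \<beta> D)" and ?N = "(k + 1) * p"
    have A: "?A \<in> carrier_mat ?N ?N" using companion_carrier by (rule map_carrier_mat[THEN iffD2])
    have "0 \<le> L" using hessian_entry_bound[OF D m, of 0 0] p by simp
    hence le: "\<bar>state_coeff k \<beta> j\<bar> + \<bar>\<alpha> j\<bar> * (2 * L) \<le> C" if "j \<le> k" for j
      unfolding C_def using that by (intro member_le_sum) auto
    have entry: "norm (?A $$ (r, s)) \<le> 1 + \<bar>C\<bar>" if rs: "r < ?N" "s < ?N" for r s
    proof (cases "r div p < k")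
      case True
      thus ?thesis using rs by (simp add: companion_def)
    next
      case False
      define j where "j = k - s div p"
      have "\<bar>D $$ (r mod p, s mod p)\<bar> \<le> 2 * L"
        using p by (intro hessian_entry_bound[OF D m]) auto
      hence "\<bar>\<alpha> j * D $$ (r mod p, s mod p)\<bar> \<le> \<bar>\<alpha> j\<bar> * (2 * L)"
        by (simp add: abs_mult mult_left_mono)
      moreover have "\<bar>state_coeff k \<beta> j * (if r mod p = s mod p then 1 else 0)\<bar> \<le> \<bar>state_coeff k \<beta> j\<bar>"
        by simp
      ultimately have "\<bar>state_coeff k \<beta> j * (if r mod p = s mod p then 1 else 0)
          - \<alpha> j * D $$ (r mod p, s mod p)\<bar> \<le> C"
        using le[of j] by (intro order_trans[OF abs_triangle_ineq4]) (simp add: j_def)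
      thus ?thesis using rs False by (simp add: companion_def j_def del: of_real_diff of_real_mult)
    qed
    have "spectral_radius ?A \<in> norm ` spectrum ?A"
      using spectral_radius_mem_max(1)[OF A] p by simp
    thus ?thesis using eigenvalue_norm_le[OF A _ entry] by (auto simp: spectrum_def)
  qed
  thus ?thesis by (intro bdd_aboveI2)
qed

section \<open>Eigenvalues of the companion matrix for scalar Hessians\<close>

text \<open>The eigenvector is the Vandermonde vector (1, z, ..., z^k) placed in the first
  coordinate of each block. The shift rows multiply it by z, and the last block row does so by the
  characteristic equation.\<close>

lemma companion_scalar_eigenvalue:
  fixes z :: complex
  assumes p: "1 \<le> p"
    and z: "z ^ Suc k = (\<Sum>b\<le>k. of_real (state_coeff k \<beta> (k - b) - \<alpha> (k - b) * d) * z ^ b)"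
  shows "eigenvalue (map_mat complex_of_real (companion p k \<alpha> \<beta> (d \<cdot>\<^sub>m 1\<^sub>m p))) z"
proof -
  define A where "A = map_mat complex_of_real (companion p k \<alpha> \<beta> (d \<cdot>\<^sub>m 1\<^sub>m p))"
  let ?N = "(k + 1) * p"
  have A: "A \<in> carrier_mat ?N ?N"
    unfolding A_def using companion_carrier by (rule map_carrier_mat[THEN iffD2])
  have A_index: "A $$ (r, s) = of_real (if r div p < k then (if s = r + p then 1 else 0)
      else state_coeff k \<beta> (k - s div p) * (if r mod p = s mod p then 1 else 0)
        - \<alpha> (k - s div p) * (if r mod p = s mod p then d else 0))" if "r < ?N" "s < ?N" for r s
  proof -
    have "r mod p < p" "s mod p < p" using p by auto
    thus ?thesis using that by (simp add: A_def companion_def)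
  qed
  define v where "v = vec ?N (\<lambda>r. if r mod p = 0 then z ^ (r div p) else 0)"
  have N: "0 < ?N" using p by simp
  have v: "v \<in> carrier_vec ?N" by (simp add: v_def)
  have "v $ 0 = 1" using N by (simp add: v_def)
  hence v0: "v \<noteq> 0\<^sub>v ?N" using N by (metis index_zero_vec(1) zero_neq_one)
  have "A *\<^sub>v v = z \<cdot>\<^sub>v v"
  proof (rule eq_vecI)
    fix r assume "r < dim_vec (z \<cdot>\<^sub>v v)"
    hence r: "r < ?N" by (simp add: v_def)
    have dr: "r div p \<le> k" using r p by (metis Suc_eq_plus1 less_Suc_eq_le less_mult_imp_div_less)
    have "(A *\<^sub>v v) $ r = (\<Sum>s = 0..<?N. A $$ (r, s) * v $ s)"
      using r v A by (simp add: scalar_prod_def)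
    also have "\<dots> = z * v $ r"
    proof (cases "r div p < k")
      case True
      hence "r < k * p" using p by (simp add: div_less_iff_less_mult)
      hence rp: "r + p < ?N" by simp
      have "(\<Sum>s = 0..<?N. A $$ (r, s) * v $ s) = (\<Sum>s = 0..<?N. if s = r + p then v $ s else 0)"
        by (rule sum.cong) (use r True in \<open>auto simp: A_index\<close>)
      also have "\<dots> = v $ (r + p)" using rp by simp
      also have "\<dots> = z * v $ r" using r rp p by (simp add: v_def)
      finally show ?thesis .
    next
      case False
      hence rk: "r div p = k" using dr by simp
      have lt: "b * p < ?N" if "b \<le> k" for b
        using that p by (intro mult_less_mono1) auto
      \<comment> \<open>Only the first index b * p of each block meets a nonzero entry of
        \<open>v\<close>.\<close>
      have "(\<Sum>s = 0..<?N. A $$ (r, s) * v $ s) = (\<Sum>s \<in> (\<lambda>b. b * p) ` {..k}. A $$ (r, s) * v $ s)"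
      proof (rule sum.mono_neutral_right)
        show "\<forall>s \<in> {0..<?N} - (\<lambda>b. b * p) ` {..k}. A $$ (r, s) * v $ s = 0"
        proof
          fix s assume s: "s \<in> {0..<?N} - (\<lambda>b. b * p) ` {..k}"
          hence "s div p \<le> k" by (metis DiffD1 Suc_eq_plus1 atLeastLessThan_iff less_Suc_eq_le less_mult_imp_div_less)
          hence "s \<noteq> s div p * p" using s by blast
          hence "s mod p \<noteq> 0" by (metis add.right_neutral div_mult_mod_eq)
          thus "A $$ (r, s) * v $ s = 0" using s by (simp add: v_def)
        qed
      qed (use lt in auto)
      also have "\<dots> = (\<Sum>b\<le>k. A $$ (r, b * p) * v $ (b * p))"
        using p by (subst sum.reindex) (auto simp: inj_on_def)
      also have "\<dots> = (\<Sum>b\<le>k. (of_real (state_coeff k \<beta> (k - b) - \<alpha> (k - b) * d) * z ^ b) *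
          (if r mod p = 0 then 1 else 0))"
        by (rule sum.cong) (use r False lt p in \<open>auto simp: A_index v_def algebra_simps\<close>)
      also have "\<dots> = z ^ Suc k * (if r mod p = 0 then 1 else 0)"
        unfolding z by (simp flip: sum_distrib_right)
      also have "\<dots> = z * v $ r" using r rk by (simp add: v_def)
      finally show ?thesis .
    qed
    finally show "(A *\<^sub>v v) $ r = (z \<cdot>\<^sub>v v) $ r" using r v by simp
  qed (use A v in auto)
  thus ?thesis using v v0 A unfolding A_def[symmetric] eigenvalue_def eigenvector_def by auto
qed

lemma norm_le_conv_rate:
  fixes z :: complex
  assumes p: "1 \<le> p" and m: "0 \<le> m" and d: "m \<le> d" "d \<le> L"
    and z: "z ^ Suc k = (\<Sum>b\<le>k. of_real (state_coeff k \<beta> (k - b) - \<alpha> (k - b) * d) * z ^ b)"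
  shows "norm z \<le> conv_rate p k \<alpha> \<beta> m L"
proof -
  let ?A = "map_mat complex_of_real (companion p k \<alpha> \<beta> (d \<cdot>\<^sub>m 1\<^sub>m p))"
  have A: "?A \<in> carrier_mat ((k + 1) * p) ((k + 1) * p)" using companion_carrier by (rule map_carrier_mat[THEN iffD2])
  have "norm z \<le> spectral_radius ?A"
    using spectral_radius_mem_max(2)[OF A] companion_scalar_eigenvalue[OF p z] p
    by (simp add: spectrum_def)
  also have "\<dots> \<le> conv_rate p k \<alpha> \<beta> m L"
    unfolding conv_rate_def
    by (rule cSUP_upper[OF scalar_hessian[OF d] bdd_above_spectral_radius_companion[OF m p]])
  finally show ?thesis .
qed

section \<open>Tracking of monomial trajectories and the moment conditions\<close>

lemma state_coeff_sum:
  fixes y :: "nat \<Rightarrow> 'a :: real_algebra_1"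
  shows "(\<Sum>j\<le>k. of_real (state_coeff k \<beta> j) * y j) = y 0 + (\<Sum>j<k. of_real (\<beta> j) * (y j - y (Suc j)))"
proof -
  have "(\<Sum>j\<le>k. of_real (state_coeff k \<beta> j) * y j) =
      (\<Sum>j\<le>k. if j = 0 then y 0 else 0) + (\<Sum>j\<le>k. if j < k then of_real (\<beta> j) * y j else 0)
      - (\<Sum>j\<le>k. if j = 0 then 0 else of_real (\<beta> (j - 1)) * y j)"
    unfolding sum.distrib[symmetric] sum_subtractf[symmetric]
    by (rule sum.cong) (auto simp: state_coeff_def algebra_simps)
  also have "(\<Sum>j\<le>k. if j < k then of_real (\<beta> j) * y j else 0) = (\<Sum>j<k. of_real (\<beta> j) * y j)"
    by (simp add: lessThan_Suc_atMost[symmetric])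
  also have "(\<Sum>j\<le>k. if j = 0 then 0 else of_real (\<beta> (j - 1)) * y j) = (\<Sum>j<k. of_real (\<beta> j) * y (Suc j))"
    by (simp only: lessThan_Suc_atMost[symmetric] sum.lessThan_Suc_shift) simp
  finally show ?thesis by (simp add: sum_subtractf right_diff_distrib)
qed

lemma poly_tendsto_0_imp_eq_0:
  fixes q :: "real poly"
  assumes "(\<lambda>t. poly q (real t)) \<longlonglongrightarrow> 0"
  shows "q = 0"
proof (cases "degree q = 0")
  case True
  then obtain c where "q = [:c:]" by (rule degree_eq_zeroE)
  thus ?thesis using assms by (simp add: LIMSEQ_const_iff)
next
  case False
  hence "filterlim (\<lambda>t. poly q (real t)) at_infinity sequentially"
    by (intro filterlim_compose[OF filterlim_poly_at_infinity]
        filterlim_compose[OF filterlim_at_top_imp_at_infinity filterlim_real_sequentially] filterlim_ident)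
       auto
  thus ?thesis using not_tendsto_and_filterlim_at_infinity[OF _ assms] by simp
qed

lemma monomial_cost_in_cost_class:
  assumes "0 < m" and "m \<le> L" and "d < n"
  shows "(\<lambda>x t. 1 / 2 * ((x - vec p (\<lambda>_. real t ^ d)) \<bullet>
      ((m \<cdot>\<^sub>m 1\<^sub>m p) *\<^sub>v (x - vec p (\<lambda>_. real t ^ d))))) \<in> cost_class n p m L"
proof -
  define a where "a j = vec p (\<lambda>_. if j = d then 1 else 0 :: real)" for j
  have "poly_traj n p a t = vec p (\<lambda>_. real t ^ d)" for t
  proof -
    have "(\<Sum>j<n. a j $ i * real t ^ j) = real t ^ d" if "i < p" for i
    proof -
      have "(\<Sum>j<n. a j $ i * real t ^ j) = (\<Sum>j<n. if j = d then real t ^ d else 0)"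
        using that by (intro sum.cong) (auto simp: a_def)
      thus ?thesis using assms by simp
    qed
    thus ?thesis by (auto simp: poly_traj_def)
  qed
  moreover have "\<forall>j<n. a j \<in> carrier_vec p" by (simp add: a_def)
  moreover have "m \<cdot>\<^sub>m 1\<^sub>m p \<in> hessians p m L" using assms by (intro scalar_hessian) auto
  ultimately show ?thesis
    unfolding cost_class_def by (auto intro!: bexI[of _ "m \<cdot>\<^sub>m 1\<^sub>m p"] exI[of _ a] exI[of _ "\<lambda>_. 0"])
qed

text \<open>Global convergence quantifies over runs, so a run has to be exhibited before anything
  follows from it.\<close>

lemma delay_recursion_exists:
  fixes c :: "nat \<Rightarrow> real" and g :: "nat \<Rightarrow> real"
  shows "\<exists>x. \<forall>t\<ge>k. x (Suc t) = (\<Sum>j\<le>k. c j * x (t - j)) + g t"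
proof -
  \<comment> \<open>With the index shifted by one, the value at t refers only to strictly smaller
    times when k < t, so well-founded recursion applies; the values up to k are
    unconstrained.\<close>
  have "\<exists>x. \<forall>t. k < t \<longrightarrow> x t = (\<Sum>j\<le>k. c j * x (t - 1 - j)) + g (t - 1)"
  proof (rule dependent_wf_choice[OF wf_less_than])
    fix f h :: "nat \<Rightarrow> real" and t r
    assume "\<And>z. (z, t) \<in> less_than \<Longrightarrow> f z = h z"
    hence "k < t \<Longrightarrow> f (t - 1 - j) = h (t - 1 - j)" for j by simp
    thus "(k < t \<longrightarrow> r = (\<Sum>j\<le>k. c j * f (t - 1 - j)) + g (t - 1)) =
        (k < t \<longrightarrow> r = (\<Sum>j\<le>k. c j * h (t - 1 - j)) + g (t - 1))"
      by (cases "k < t") simp_all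
  qed auto
  then obtain x where x: "\<And>t. k < t \<Longrightarrow> x t = (\<Sum>j\<le>k. c j * x (t - 1 - j)) + g (t - 1)" by blast
  have "x (Suc t) = (\<Sum>j\<le>k. c j * x (t - j)) + g t" if "k \<le> t" for t
    using x[of "Suc t"] that by simp
  thus ?thesis by blast
qed

text \<open>The sequence is the residual of t^d in the recursion without gradient terms. The
  tracking error satisfies the full linear recursion with this residual as forcing; as the error
  tends to zero, so does the residual.\<close>

lemma forcing_tendsto_0:
  assumes p: "1 \<le> p" and m: "0 < m" "m \<le> L" and d: "d < n"
    and conv: "\<And>f. f \<in> cost_class n p m L \<Longrightarrow> globally_convergent p k \<alpha> \<beta> f"
  shows "(\<lambda>t. real (Suc t) ^ d - (\<Sum>j\<le>k. state_coeff k \<beta> j * (real t - real j) ^ d)) \<longlonglongrightarrow> 0"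
proof -
  define z where "z t = vec p (\<lambda>_. real t ^ d)" for t
  define f where "f = (\<lambda>x t. 1 / 2 * ((x - z t) \<bullet> ((m \<cdot>\<^sub>m 1\<^sub>m p) *\<^sub>v (x - z t))))"
  have f: "globally_convergent p k \<alpha> \<beta> f"
    unfolding f_def z_def by (intro conv monomial_cost_in_cost_class m d)
  have H: "m \<cdot>\<^sub>m 1\<^sub>m p \<in> hessians p m L" using m by (intro scalar_hessian) auto
  have z: "z t \<in> carrier_vec p" for t by (simp add: z_def)
  have min: "minimizer p (\<lambda>y. f y t) = z t" for t
    by (rule minimizer_quadratic[OF m(1) H _ z, where c = 0]) (simp add: f_def)
  have grad: "gradient p (\<lambda>y. f y t) x = m \<cdot>\<^sub>v (x - z t)" if x: "x \<in> carrier_vec p" for x t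
    using gradient_quadratic[of "m \<cdot>\<^sub>m 1\<^sub>m p" p "\<lambda>y. f y t" "z t" 0 x] H x z[of t]
    by (simp add: f_def hessians_def smult_mat_mult_vec1)
  define c where "c j = state_coeff k \<beta> j - \<alpha> j * m" for j
  \<comment> \<open>The gradient m (\<xi> - t^d) is split: its part in \<xi> enters the coefficients
    \<open>c\<close>, its part in t^d becomes the forcing term. All coordinates obey this one scalar
    recursion.\<close>
  obtain \<xi> where \<xi>: "\<And>t. k \<le> t \<Longrightarrow>
      \<xi> (Suc t) = (\<Sum>j\<le>k. c j * \<xi> (t - j)) + (\<Sum>j\<le>k. \<alpha> j * m * real (t - j) ^ d)"
    using delay_recursion_exists[of k c "\<lambda>t. \<Sum>j\<le>k. \<alpha> j * m * real (t - j) ^ d"] by blast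
  have "is_run p k \<alpha> \<beta> f (\<lambda>t. vec p (\<lambda>_. \<xi> t))"
    unfolding is_run_def
  proof (intro conjI allI impI)
    fix t i assume t: "k \<le> t" and i: "i < p"
    have G: "gradient p (\<lambda>y. f y (t - j)) (vec p (\<lambda>_. \<xi> (t - j))) $ i =
        m * (\<xi> (t - j) - real (t - j) ^ d)" for j
      using i by (simp add: grad z_def)
    have "\<xi> (t + 1) = (\<Sum>j\<le>k. state_coeff k \<beta> j * \<xi> (t - j))
        - (\<Sum>j\<le>k. \<alpha> j * (m * (\<xi> (t - j) - real (t - j) ^ d)))"
      using \<xi>[OF t] by (simp add: c_def sum.distrib sum_subtractf algebra_simps)
    thus "vec p (\<lambda>_. \<xi> (t + 1)) $ i = vec p (\<lambda>_. \<xi> t) $ i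
        + (\<Sum>j<k. \<beta> j * (vec p (\<lambda>_. \<xi> (t - j)) $ i - vec p (\<lambda>_. \<xi> (t - j - 1)) $ i))
        - (\<Sum>j\<le>k. \<alpha> j * gradient p (\<lambda>y. f y (t - j)) (vec p (\<lambda>_. \<xi> (t - j))) $ i)"
      unfolding G using i state_coeff_sum[of k \<beta> "\<lambda>j. \<xi> (t - j)"] by simp
  qed simp
  hence "(\<lambda>t. vec p (\<lambda>_. \<xi> t) $ 0 - minimizer p (\<lambda>y. f y t) $ 0) \<longlonglongrightarrow> 0"
    using f p unfolding globally_convergent_def by (metis One_nat_def Suc_le_lessD)
  hence e: "(\<lambda>t. \<xi> t - real t ^ d) \<longlonglongrightarrow> 0" using p by (simp add: min z_def)
  define e where "e t = \<xi> t - real t ^ d" for t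
  have e0: "e \<longlonglongrightarrow> 0" using e by (simp add: e_def[abs_def])
  have "(\<lambda>t. e (t - j)) \<longlonglongrightarrow> 0" for j
    using e0 by (rule filterlim_compose) (rule filterlim_minus_const_nat_at_top)
  hence "(\<lambda>t. (\<Sum>j\<le>k. c j * e (t - j)) - e (Suc t)) \<longlonglongrightarrow> (\<Sum>j\<le>k. c j * 0) - 0"
    by (intro tendsto_intros LIMSEQ_Suc[OF e0])
  \<comment> \<open>The \<alpha> terms cancel. The restriction to t >= k is needed for
    \<open>real (t - j)\<close> to equal \<open>real t - real j\<close>.\<close>
  moreover have "eventually (\<lambda>t. (\<Sum>j\<le>k. c j * e (t - j)) - e (Suc t) =
      real (Suc t) ^ d - (\<Sum>j\<le>k. state_coeff k \<beta> j * (real t - real j) ^ d)) sequentially"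
    using eventually_ge_at_top[of k]
  proof eventually_elim
    case (elim t)
    have "(\<Sum>j\<le>k. state_coeff k \<beta> j * (real t - real j) ^ d) = (\<Sum>j\<le>k. state_coeff k \<beta> j * real (t - j) ^ d)"
      using elim by (intro sum.cong) (auto simp: of_nat_diff)
    thus ?case using \<xi>[OF elim]
      by (simp add: e_def c_def sum.distrib sum_subtractf algebra_simps)
  qed
  ultimately show ?thesis by (simp add: tendsto_cong)
qed

text \<open>The residual is a polynomial in t tending to zero, hence the zero polynomial, and can be
  evaluated at t = -1. The right-hand side is 1 for d = 0 and 0 otherwise.\<close>

lemma moment_conditions:
  assumes p: "1 \<le> p" and m: "0 < m" "m \<le> L" and d: "d < n"
    and conv: "\<And>f. f \<in> cost_class n p m L \<Longrightarrow> globally_convergent p k \<alpha> \<beta> f"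
  shows "(\<Sum>j\<le>k. state_coeff k \<beta> j * real (Suc j) ^ d) = 0 ^ d"
proof -
  define q where "q = [:1, 1:] ^ d - (\<Sum>j\<le>k. Polynomial.smult (state_coeff k \<beta> j) ([:- real j, 1:] ^ d))"
  have q: "poly q x = (1 + x) ^ d - (\<Sum>j\<le>k. state_coeff k \<beta> j * (x - real j) ^ d)" for x
    by (simp add: q_def poly_sum)
  have "q = 0"
    using forcing_tendsto_0[OF p m d conv] by (intro poly_tendsto_0_imp_eq_0) (simp add: q)
  hence "(\<Sum>j\<le>k. state_coeff k \<beta> j * (- 1 - real j) ^ d) = 0 ^ d"
    using q[of "-1"] by simp
  moreover have "(- 1 - real j) ^ d = (- 1) ^ d * real (Suc j) ^ d" for j
    by (simp add: power_mult_distrib[symmetric])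
  ultimately have "(- 1) ^ d * (\<Sum>j\<le>k. state_coeff k \<beta> j * real (Suc j) ^ d) = 0 ^ d"
    by (simp add: sum_distrib_left mult.left_commute)
  thus ?thesis by (cases d) auto
qed

text \<open>The coefficients are 1 at index 0 and minus the state coefficients at indices j + 1. The
  constant 1 contributes \<open>0 ^ d\<close> to the d-th moment, which the moment conditions cancel
  exactly.\<close>

lemma difference_power_dvd_delay_polynomial:
  assumes p: "1 \<le> p" and m: "0 < m" "m \<le> L"
    and conv: "\<And>f. f \<in> cost_class n p m L \<Longrightarrow> globally_convergent p k \<alpha> \<beta> f"
  shows "[:1, -1:] ^ n dvd (1 - (\<Sum>j\<le>k. monom (of_real (state_coeff k \<beta> j)) (Suc j)) :: complex poly)"
proof -
  define P where "P = (1 - (\<Sum>j\<le>k. monom (of_real (state_coeff k \<beta> j)) (Suc j)) :: complex poly)"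
  have c0: "Polynomial.coeff P 0 = 1" by (simp add: P_def coeff_sum)
  have cS: "Polynomial.coeff P (Suc i) = (if i \<le> k then - of_real (state_coeff k \<beta> i) else 0)" for i
    by (simp add: P_def coeff_sum)
  have deg: "degree P \<le> Suc k"
  proof (rule degree_le, intro allI impI)
    fix i assume "Suc k < i"
    thus "Polynomial.coeff P i = 0" by (cases i) (auto simp: cS)
  qed
  have "(\<Sum>i\<le>Suc k. Polynomial.coeff P i * of_nat i ^ d) = 0" if "d < n" for d
  proof -
    have "(\<Sum>i\<le>Suc k. Polynomial.coeff P i * of_nat i ^ d) =
        0 ^ d - (\<Sum>j\<le>k. of_real (state_coeff k \<beta> j) * of_nat (Suc j) ^ d)"
      by (simp only: sum.atMost_Suc_shift) (simp add: c0 cS sum_negf del: of_nat_Suc)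
    also have "(\<Sum>j\<le>k. of_real (state_coeff k \<beta> j) * of_nat (Suc j) ^ d) =
        (of_real (\<Sum>j\<le>k. state_coeff k \<beta> j * real (Suc j) ^ d) :: complex)"
      by simp
    also have "\<dots> = of_real (0 ^ d)"
      by (simp only: moment_conditions[OF p m that conv])
    finally show ?thesis by simp
  qed
  from order_of_moment_conditions[OF this deg] have "[:-1, 1:] ^ n dvd P"
    by (auto simp: order_divides)
  moreover have "[:1, -1:] ^ n = (-1) ^ n * [:-1, 1:: complex:] ^ n"
    by (simp flip: power_mult_distrib)
  ultimately show ?thesis unfolding P_def[symmetric] by (auto simp: dvd_def mult.assoc intro: exI[of _ "(-1) ^ n * _"])
qed

section \<open>From zeros in the delay variable to the bound on the rate\<close>

text \<open>Multiplying the root equation by z^(k+1) with z = 1/w and reversing the summation index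
  gives the characteristic equation of z.\<close>

lemma inverse_root_le_conv_rate:
  fixes w :: complex
  assumes p: "1 \<le> p" and m: "0 \<le> m" and d: "m \<le> d" "d \<le> L" and w: "w \<noteq> 0"
    and root: "(\<Sum>j\<le>k. of_real (state_coeff k \<beta> j - \<alpha> j * d) * w ^ Suc j) = 1"
  shows "inverse (norm w) \<le> conv_rate p k \<alpha> \<beta> m L"
proof -
  define z where "z = inverse w"
  have zw: "z * w = 1" using w by (simp add: z_def)
  have "z ^ Suc k = (\<Sum>j\<le>k. of_real (state_coeff k \<beta> j - \<alpha> j * d) * (z ^ Suc k * w ^ Suc j))"
    using arg_cong[OF root, of "\<lambda>u. z ^ Suc k * u"]
    by (simp only: sum_distrib_left mult.left_commute mult_1_right)
  also have "\<dots> = (\<Sum>j\<le>k. of_real (state_coeff k \<beta> j - \<alpha> j * d) * z ^ (k - j))"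
  proof (rule sum.cong[OF refl])
    fix j assume "j \<in> {..k}"
    hence "z ^ Suc k = z ^ (k - j) * z ^ Suc j" by (simp flip: power_add)
    hence "z ^ Suc k * w ^ Suc j = z ^ (k - j) * (z * w) ^ Suc j"
      by (simp only: power_mult_distrib mult.assoc)
    thus "of_real (state_coeff k \<beta> j - \<alpha> j * d) * (z ^ Suc k * w ^ Suc j) =
        of_real (state_coeff k \<beta> j - \<alpha> j * d) * z ^ (k - j)"
      by (simp only: zw power_one mult_1_right)
  qed
  also have "\<dots> = (\<Sum>b\<le>k. of_real (state_coeff k \<beta> (k - b) - \<alpha> (k - b) * d) * z ^ b)"
    by (rule sum.reindex_bij_witness[of _ "\<lambda>j. k - j" "\<lambda>j. k - j"]) auto
  finally have "norm z \<le> conv_rate p k \<alpha> \<beta> m L" by (rule norm_le_conv_rate[OF p m d])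
  thus ?thesis by (simp add: z_def norm_inverse)
qed

theorem theorem1:
  fixes n p k :: nat and m L \<kappa> :: real and \<alpha> \<beta> :: "nat \<Rightarrow> real"
  assumes "n \<ge> 1" and "p \<ge> 1" and "k \<ge> 1"
    and "0 < m" and "m < L" and "\<kappa> = L / m"
    and "(\<Sum>j\<le>k. \<alpha> j) \<noteq> 0"
    and "\<And>f. f \<in> cost_class n p m L \<Longrightarrow> globally_convergent p k \<alpha> \<beta> f"
  shows "conv_rate p k \<alpha> \<beta> m L \<ge> ((sqrt \<kappa> - 1) / (sqrt \<kappa> + 1)) powr (1 / real n)
    \<and> ((sqrt \<kappa> - 1) / (sqrt \<kappa> + 1)) powr (1 / real n)
        = ((sqrt L - sqrt m) / (sqrt L + sqrt m)) powr (1 / real n)"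
proof -
  note m = \<open>0 < m\<close> and L = \<open>m < L\<close>
  define q where "q = (sqrt L - sqrt m) / (sqrt L + sqrt m)"
  have q: "(sqrt \<kappa> - 1) / (sqrt \<kappa> + 1) = q"
    unfolding q_def \<open>\<kappa> = L / m\<close> using m L by (intro sqrt_ratio_eq) auto
  have "0 < sqrt m" "sqrt m < sqrt L" using m L by auto
  hence "0 < sqrt L - sqrt m" "sqrt L - sqrt m < sqrt L + sqrt m" "0 < sqrt L + sqrt m"
    by linarith+
  hence q01: "0 < q" "q < 1" by (simp_all only: q_def divide_pos_pos divide_less_eq_1_pos)
  have "q powr (1 / real n) \<le> conv_rate p k \<alpha> \<beta> m L"
  proof (rule ccontr)
    assume "\<not> ?thesis"
    \<comment> \<open>The maximum with 0 makes \<rho> positive without a sign for the rate, so that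
      R = 1/\<rho> can serve as the radius.\<close>
    hence "max 0 (conv_rate p k \<alpha> \<beta> m L) < q powr (1 / real n)" using q01 by simp
    then obtain \<rho> where \<rho>: "max 0 (conv_rate p k \<alpha> \<beta> m L) < \<rho>" "\<rho> < q powr (1 / real n)"
      using dense by blast
    have \<rho>0: "0 < \<rho>" "conv_rate p k \<alpha> \<beta> m L < \<rho>" using \<rho>(1) by auto
    have "q powr (1 / real n) < 1"
      using q01 \<open>n \<ge> 1\<close> powr_less_mono2[of "1 / real n" q 1] by simp
    hence \<rho>1: "\<rho> < 1" using \<rho>(2) by simp
    define P where "P = (1 - (\<Sum>j\<le>k. monom (of_real (state_coeff k \<beta> j)) (Suc j)) :: complex poly)"
    define A where "A = ((\<Sum>j\<le>k. monom (of_real (\<alpha> j)) (Suc j)) :: complex poly)"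
    have "[:1, -1:] ^ n dvd P"
      unfolding P_def using L by (intro difference_power_dvd_delay_polynomial[OF assms(2) m _ assms(8)]) auto
    then obtain Q where Q: "P = [:1, -1:] ^ n * Q" by (rule dvdE)
    have "inverse \<rho> ^ n * q \<le> 1"
      unfolding q_def
    proof (rule robust_root_bound[OF Q _ _ m L])
      show "poly P 0 = 1" "poly A 0 = 0" by (simp_all add: P_def A_def poly_sum poly_monom)
      show "1 < inverse \<rho>" using \<rho>0 \<rho>1 by (simp add: one_less_inverse)
      fix w :: complex and d :: real
      assume w: "norm w \<le> inverse \<rho>" and d: "m \<le> d" "d \<le> L"
      show "poly P w + of_real d * poly A w \<noteq> 0"
      \<comment> \<open>A zero w in this disc would yield an eigenvalue 1/w of modulus at least
        \<rho>, which exceeds the rate.\<close>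
      proof
        assume 0: "poly P w + of_real d * poly A w = 0"
        have "poly P w + of_real d * poly A w =
            1 - (\<Sum>j\<le>k. of_real (state_coeff k \<beta> j - \<alpha> j * d) * w ^ Suc j)"
          by (simp add: P_def A_def poly_sum poly_monom sum_distrib_left sum_subtractf algebra_simps)
        hence root: "(\<Sum>j\<le>k. of_real (state_coeff k \<beta> j - \<alpha> j * d) * w ^ Suc j) = 1"
          using 0 by simp
        hence "w \<noteq> 0" by auto
        hence "inverse (norm w) \<le> conv_rate p k \<alpha> \<beta> m L"
          using m by (intro inverse_root_le_conv_rate[OF assms(2) _ d _ root]) auto
        moreover have "\<rho> \<le> inverse (norm w)"
          using le_imp_inverse_le[OF w] \<open>w \<noteq> 0\<close> by simp
        ultimately show False using \<rho>0 by simp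
      qed
    qed
    \<comment> \<open>The analytic bound gives q <= \<rho>^n, while \<rho> was chosen below the n-th
      root of q.\<close>
    hence "q \<le> \<rho> ^ n" using \<rho>0 by (simp add: power_inverse field_simps)
    also have "\<dots> < (q powr (1 / real n)) ^ n"
      using \<rho>(2) \<rho>0 \<open>n \<ge> 1\<close> by (intro power_strict_mono) auto
    also have "\<dots> = q"
      using q01 \<open>n \<ge> 1\<close> by (simp add: powr_powr flip: powr_realpow)
    finally show False by simp
  qed
  thus ?thesis unfolding q using q_def by simp
qed

end
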